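(* Let $V$ be a b-complete subsemimodule of $\mathbb{R}_{\max}^n$ and let $x\in\mathbb{R}_{\max}^n$, $x\notin V$, be such that all coordinates of $P_V(x)$ (and hence also of $x$) are $>-\infty$. Let $$J=\{j\in[n]\mid x_j=P_V(x)_j\},\qquad J^c=\{j\in[n]\mid x_j>P_V(x)_j\}.$$ Then the following closed half-space separates $x$ from $V$ (that is, $V\subseteq H'_{V,x}$ and $x\notin H'_{V,x}$): $$H'_{V,x}=\Big\{h\in\mathbb{R}_{\max}^n\ \Big|\ \max_{j\in J}(h_j-x_j)\geq\max_{j\in J^c}\big(h_j-P_V(x)_j\big)\Big\}=\Big\{h\in\mathbb{R}_{\max}^n\ \Big|\ \min_{j\in J}\,h_j\backslash x_j\leq\min_{j\in J^c}\,h_j\backslash P_V(x)_j\Big\}.$$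
   Context: $\mathbb{R}_{\max}=\mathbb{R}\cup\{-\infty\}$ with addition $\oplus=\max$ and multiplication $\otimes=+$; $\overline{\mathbb{R}}=\mathbb{R}\cup\{-\infty,+\infty\}$ with the convention $(-\infty)+(+\infty)=(+\infty)+(-\infty)=-\infty$; $[n]=\{1,\dots,n\}$. For scalars, $\mu\backslash\nu:=\max\{\lambda\in\overline{\mathbb{R}}\mid\mu+\lambda\leq\nu\}$. $\mathbb{R}_{\max}^n$ has the entrywise order and $x\lambda$ denotes the vector with entries $x_i+\lambda$. A subsemimodule of $\mathbb{R}_{\max}^n$ is a subset containing the vector with all entries $-\infty$ and stable under entrywise max and under $x\mapsto x\lambda$ for all $\lambda\in\mathbb{R}_{\max}$; it is b-complete if the supremum of any of its subsets that is bounded from above belongs to it. For a b-complete subsemimodule $V$, $P_V(x):=\max\{v\in V\mid v\leq x\}$. A closed half-space of $\mathbb{R}_{\max}^n$ is a set of the form $\{h\in\mathbb{R}_{\max}^n\mid\max_i(a_i+h_i)\geq\max_i(b_i+h_i)\}$ with $a_i,b_i\in\mathbb{R}_{\max}$. *)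

theory Defs
  imports "HOL-Analysis.Analysis" "HOL-Library.Lub_Glb"
begin

text \<open>
  The completed max-plus semiring is the type \<^typ>\<open>ereal\<close>, and the max-plus semiring
  is its subset of elements different from \<open>\<infinity>\<close>. The order on \<open>ereal ^ 'n\<close> is entrywise.
\<close>

definition rmax :: "ereal set" where
  "rmax = {a. a \<noteq> \<infinity>}"

definition rmax_vecs :: "(ereal ^ 'n) set" where
  "rmax_vecs = {x. \<forall>i. x $ i \<in> rmax}"

text \<open>
  In \<^typ>\<open>ereal\<close> one has \<open>-\<infinity> + \<infinity> = \<infinity>\<close>, whereas max-plus multiplication takes the
  value \<open>-\<infinity>\<close> there. The two agree on \<^const>\<open>rmax\<close>, where plain \<open>+\<close> is used below.
\<close>

definition mp_mult :: "ereal \<Rightarrow> ereal \<Rightarrow> ereal" where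
  "mp_mult a b = (if a = -\<infinity> \<or> b = -\<infinity> then -\<infinity> else a + b)"

definition resid :: "ereal \<Rightarrow> ereal \<Rightarrow> ereal" where
  "resid \<mu> \<nu> = (GREATEST l. mp_mult \<mu> l \<le> \<nu>)"

definition subsemimodule :: "(ereal ^ 'n) set \<Rightarrow> bool" where
  "subsemimodule V \<longleftrightarrow>
     V \<subseteq> rmax_vecs \<and>
     (\<chi> i. -\<infinity>) \<in> V \<and>
     (\<forall>u\<in>V. \<forall>v\<in>V. (\<chi> i. max (u $ i) (v $ i)) \<in> V) \<and>
     (\<forall>v\<in>V. \<forall>l\<in>rmax. (\<chi> i. v $ i + l) \<in> V)"

text \<open>
  Boundedness and suprema are taken in \<^const>\<open>rmax_vecs\<close>: every set of vectors is bounded by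
  the vector with all entries \<open>\<infinity>\<close>.
\<close>

definition b_complete :: "(ereal ^ 'n) set \<Rightarrow> bool" where
  "b_complete V \<longleftrightarrow>
     (\<forall>S\<subseteq>V. (\<exists>u. isUb rmax_vecs S u) \<longrightarrow> (\<exists>s\<in>V. isLub rmax_vecs S s))"

definition proj :: "(ereal ^ 'n) set \<Rightarrow> ereal ^ 'n \<Rightarrow> ereal ^ 'n" where
  "proj V x = (GREATEST v. v \<in> V \<and> v \<le> x)"

definition closed_halfspace :: "(ereal ^ 'n) set \<Rightarrow> bool" where
  "closed_halfspace H \<longleftrightarrow>
     (\<exists>a\<in>rmax_vecs. \<exists>b\<in>rmax_vecs.
        H = {h \<in> rmax_vecs. Max (range (\<lambda>i. a $ i + h $ i)) \<ge> Max (range (\<lambda>i. b $ i + h $ i))})"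

end

theory Submission
  imports Defs
begin

text \<open>
  Given \<open>v \<in> V\<close> with some finite entry, put \<open>l = min\<^sub>j (x\<^sub>j - v\<^sub>j)\<close>, the largest scalar with
  \<open>v + l \<le> x\<close>. Then \<open>v + l \<in> V\<close> lies below \<open>P\<^sub>V(x)\<close>, so \<open>v\<^sub>k - P\<^sub>V(x)\<^sub>k \<le> -l\<close> for every \<open>k\<close>. At an index
  \<open>j\<close> attaining the minimum, \<open>x\<^sub>j = v\<^sub>j + l \<le> P\<^sub>V(x)\<^sub>j\<close>, hence \<open>j \<in> J\<close> and \<open>v\<^sub>j - x\<^sub>j = -l\<close>. This gives
  \<open>V \<subseteq> H'\<close>, and also \<open>J \<noteq> {}\<close> (take \<open>v = P\<^sub>V(x)\<close>).
\<close>

text \<open>The set of elements of \<open>V\<close> below \<open>x\<close> is bounded by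
  \<open>x\<close> itself, which lies in \<open>rmax_vecs\<close>, so b-completeness puts its
  supremum in \<open>V\<close>. As \<open>x\<close> is an upper bound, this supremum is again below
  \<open>x\<close>. The maximum in the definition of \<open>proj\<close> is therefore
  attained.\<close>

lemma
  assumes "b_complete V" and "x \<in> rmax_vecs" and "V \<subseteq> rmax_vecs"
  shows proj_in: "proj V x \<in> V"
    and proj_le: "proj V x \<le> x"
    and proj_greatest: "\<And>v. v \<in> V \<Longrightarrow> v \<le> x \<Longrightarrow> v \<le> proj V x"
proof -
  let ?S = "{v \<in> V. v \<le> x}"
  have x: "isUb rmax_vecs ?S x"
    using assms(2) by (auto simp: isUb_def setle_def)
  have "?S \<subseteq> V"
    by blast
  with assms(1) x obtain s where s: "s \<in> V" "isLub rmax_vecs ?S s"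
    unfolding b_complete_def by blast
  have "s \<le> x"
    using isLub_le_isUb[OF s(2) x] .
  moreover have ub: "v \<le> s" if "v \<in> V" "v \<le> x" for v
    using isLubD2[OF s(2)] that by blast
  ultimately have "proj V x = s"
    unfolding proj_def using s(1) by (intro Greatest_equality) auto
  then show "proj V x \<in> V" "proj V x \<le> x" "\<And>v. v \<in> V \<Longrightarrow> v \<le> x \<Longrightarrow> v \<le> proj V x"
    using s(1) \<open>s \<le> x\<close> ub by auto
qed

lemma exists_contact_index:
  fixes x :: "ereal ^ 'n"
  assumes V: "subsemimodule V" "b_complete V" and x: "x \<in> rmax_vecs"
    and p: "\<And>j. proj V x $ j > -\<infinity>"
    and v: "v \<in> V" "v $ m > -\<infinity>"
  obtains j where "x $ j = proj V x $ j" "\<And>k. v $ k - proj V x $ k \<le> v $ j - x $ j"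
proof -
  have sub: "V \<subseteq> rmax_vecs"
    and scale: "\<And>u l. u \<in> V \<Longrightarrow> l \<in> rmax \<Longrightarrow> (\<chi> i. u $ i + l) \<in> V"
    using V(1) by (auto simp: subsemimodule_def)
  note proj = proj_in[OF V(2) x sub] proj_le[OF V(2) x sub] proj_greatest[OF V(2) x sub]
  have vtop: "v $ i \<noteq> \<infinity>" and xtop: "x $ i \<noteq> \<infinity>" for i
    using v(1) sub x by (auto simp: rmax_vecs_def rmax_def)
  have px: "proj V x $ i \<le> x $ i" for i
    using proj(2) by (simp add: less_eq_vec_def)
  have xbot: "x $ i \<noteq> -\<infinity>" and pbot: "proj V x $ i \<noteq> -\<infinity>"
    and ptop: "proj V x $ i \<noteq> \<infinity>" for i
    using px[of i] p[of i] xtop[of i] by auto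
  \<comment> \<open>Entries with \<open>v $ i = -\<infinity>\<close> contribute
    \<open>\<infinity>\<close>, so they do not constrain the minimum.\<close>
  define l where "l = Min (range (\<lambda>i. x $ i - v $ i))"
  have l_le: "l \<le> x $ i - v $ i" for i
    unfolding l_def by (intro Min_le) auto
  have "l \<in> range (\<lambda>i. x $ i - v $ i)"
    unfolding l_def by (intro Min_in) auto
  then obtain j where j: "l = x $ j - v $ j"
    by auto
  have "l \<noteq> -\<infinity>"
    using vtop[of j] xbot[of j] xtop[of j] by (cases "x $ j"; cases "v $ j") (auto simp: j)
  \<comment> \<open>The finite entry at \<open>m\<close> is needed here: for the bottom vector every
    difference is \<open>\<infinity>\<close>, and no scalar in \<open>rmax\<close> is
    largest.\<close>
  moreover have "l \<noteq> \<infinity>"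
    using l_le[of m] v(2) vtop[of m] xtop[of m] by (cases "x $ m"; cases "v $ m") auto
  ultimately obtain r where r: "l = ereal r"
    by (cases l) auto
  have "v $ i + l \<le> x $ i" for i
    using l_le[of i] xtop[of i] xbot[of i] vtop[of i] unfolding r
    by (cases "x $ i"; cases "v $ i") auto
  then have "(\<chi> i. v $ i + l) \<le> proj V x"
    using scale[OF v(1), of l] r by (intro proj(3)) (auto simp: rmax_def less_eq_vec_def)
  then have le_p: "v $ i + l \<le> proj V x $ i" for i
    by (simp add: less_eq_vec_def)
  have vj: "v $ j - x $ j = -l" "v $ j + l = x $ j"
    using j r xtop[of j] xbot[of j] vtop[of j] by (cases "x $ j"; cases "v $ j"; auto)+
  show thesis
  proof
    show "x $ j = proj V x $ j"
      using le_p[of j] px[of j] vj(2) by simp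
    show "v $ k - proj V x $ k \<le> v $ j - x $ j" for k
      unfolding vj using le_p[of k] pbot[of k] ptop[of k] vtop[of k] unfolding r
      by (cases "proj V x $ k"; cases "v $ k") auto
  qed
qed

text \<open>Padding with the least element leaves a nonempty maximum unchanged. This links the
  maxima over \<open>J\<close> and \<open>Jc\<close> to those over all indices in
  \<open>closed_halfspace\<close>.\<close>

lemma Max_range_if_bot:
  fixes f :: "'n::finite \<Rightarrow> ereal"
  assumes "A \<noteq> {}"
  shows "Max (range (\<lambda>i. if i \<in> A then f i else -\<infinity>)) = Max (f ` A)"
proof (rule antisym)
  show "Max (range (\<lambda>i. if i \<in> A then f i else -\<infinity>)) \<le> Max (f ` A)"
    by (intro Max.boundedI) auto
  show "Max (f ` A) \<le> Max (range (\<lambda>i. if i \<in> A then f i else -\<infinity>))"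
  proof (rule Max.boundedI)
    fix y assume "y \<in> f ` A"
    then obtain i where "i \<in> A" "y = f i"
      by blast
    then show "y \<le> Max (range (\<lambda>i. if i \<in> A then f i else -\<infinity>))"
      by (intro Max_ge) (auto simp: image_iff intro!: exI[of _ i])
  qed (use assms in auto)
qed

lemma closed_halfspace_diff:
  fixes c d :: "ereal ^ 'n"
  assumes "A \<noteq> {}" "B \<noteq> {}"
    and c: "\<And>i. \<bar>c $ i\<bar> \<noteq> \<infinity>" and d: "\<And>i. \<bar>d $ i\<bar> \<noteq> \<infinity>"
  shows "closed_halfspace
    {h \<in> rmax_vecs. Max ((\<lambda>j. h $ j - c $ j) ` A) \<ge> Max ((\<lambda>j. h $ j - d $ j) ` B)}"
proof -
  define coef where
    "coef e C = (\<chi> i. if i \<in> C then - (e $ i) else -\<infinity>)" for e :: "ereal ^ 'n" and C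
  have coef_rmax: "coef e C \<in> rmax_vecs" if "\<And>i. \<bar>e $ i\<bar> \<noteq> \<infinity>" for e C
    using that
    by (simp add: coef_def rmax_vecs_def rmax_def) (metis abs_ereal_uminus abs_ereal.simps(3))
  have coef_Max: "Max (range (\<lambda>i. coef e C $ i + h $ i)) = Max ((\<lambda>j. h $ j - e $ j) ` C)"
    if "C \<noteq> {}" "h \<in> rmax_vecs" for e C h
  proof -
    \<comment> \<open>Off \<open>C\<close> the coefficient \<open>-\<infinity>\<close> absorbs
      \<open>h $ i\<close> only because \<open>h $ i\<close> is not \<open>\<infinity>\<close>; in
      \<open>ereal\<close> the sum would otherwise be \<open>\<infinity>\<close>.\<close>
    have "coef e C $ i + h $ i = (if i \<in> C then h $ i - e $ i else -\<infinity>)" for i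
      using that(2) by (auto simp: coef_def rmax_vecs_def rmax_def minus_ereal_def add.commute)
    then show ?thesis
      using Max_range_if_bot[OF that(1)] by simp
  qed
  show ?thesis
    unfolding closed_halfspace_def
    using coef_rmax[OF c, of A] coef_rmax[OF d, of B]
    by (intro bexI[of _ "coef c A"] bexI[of _ "coef d B"] Collect_cong conj_cong refl)
      (simp_all only: coef_Max assms(1,2) not_False_eq_True)
qed

text \<open>The residual is the usual difference with the sign reversed, written so that a minimum
  of residuals becomes a negated maximum of the terms in \<open>H'\<close>. For
  \<open>\<mu> = -\<infinity>\<close> every scalar is admissible and both sides are
  \<open>\<infinity>\<close>.\<close>

lemma resid_eq_uminus_diff:
  assumes "\<mu> \<noteq> \<infinity>" "\<bar>\<nu>\<bar> \<noteq> \<infinity>"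
  shows "resid \<mu> \<nu> = - (\<mu> - \<nu>)"
  unfolding resid_def
proof (rule Greatest_equality)
  show "mp_mult \<mu> (- (\<mu> - \<nu>)) \<le> \<nu>"
    using assms by (cases \<mu>; cases \<nu>) (auto simp: mp_mult_def)
  show "l \<le> - (\<mu> - \<nu>)" if "mp_mult \<mu> l \<le> \<nu>" for l
    using assms that by (cases \<mu>; cases \<nu>; cases l) (auto simp: mp_mult_def)
qed

lemma Min_uminus_ereal:
  fixes f :: "'a \<Rightarrow> ereal"
  assumes "finite A" "A \<noteq> {}"
  shows "Min ((\<lambda>i. - f i) ` A) = - Max (f ` A)"
proof (rule Min_eqI)
  have "Max (f ` A) \<in> f ` A"
    using assms by simp
  then show "- Max (f ` A) \<in> (\<lambda>i. - f i) ` A"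
    by auto
qed (use assms in auto)

theorem corollary6p2:
  fixes V :: "(ereal ^ 'n) set" and x :: "ereal ^ 'n"
    and J Jc :: "'n set" and H' :: "(ereal ^ 'n) set"
  assumes "subsemimodule V" and "b_complete V"
    and "x \<in> rmax_vecs" and "x \<notin> V"
    and "\<And>j. proj V x $ j > -\<infinity>"
    and J: "J = {j. x $ j = proj V x $ j}"
    and Jc: "Jc = {j. x $ j > proj V x $ j}"
    and H': "H' = {h \<in> rmax_vecs.
        Max ((\<lambda>j. h $ j - x $ j) ` J) \<ge> Max ((\<lambda>j. h $ j - proj V x $ j) ` Jc)}"
  shows "closed_halfspace H' \<and> V \<subseteq> H' \<and> x \<notin> H' \<and>
    H' = {h \<in> rmax_vecs.
        Min ((\<lambda>j. resid (h $ j) (x $ j)) ` J) \<le> Min ((\<lambda>j. resid (h $ j) (proj V x $ j)) ` Jc)}"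
proof -
  let ?p = "proj V x"
  have sub: "V \<subseteq> rmax_vecs"
    using assms(1) by (simp add: subsemimodule_def)
  note pV = proj_in[OF assms(2,3) sub]
  have px: "?p $ i \<le> x $ i" for i
    using proj_le[OF assms(2,3) sub] by (simp add: less_eq_vec_def)
  have xfin: "\<bar>x $ i\<bar> \<noteq> \<infinity>" and pfin: "\<bar>?p $ i\<bar> \<noteq> \<infinity>" for i
    using px[of i] assms(5)[of i] assms(3) by (auto simp: rmax_vecs_def rmax_def)
  have J_ne: "J \<noteq> {}"
    using exists_contact_index[OF assms(1,2,3,5) pV assms(5)] unfolding J by blast
  have "x \<noteq> ?p"
    using pV assms(4) by metis
  then obtain m where "x $ m \<noteq> ?p $ m"
    by (auto simp: vec_eq_iff)
  then have m: "m \<in> Jc"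
    using px[of m] by (auto simp: Jc)
  then have Jc_ne: "Jc \<noteq> {}"
    by blast
  have half: "closed_halfspace H'"
    unfolding H' by (rule closed_halfspace_diff[OF J_ne Jc_ne xfin pfin])
  have "V \<subseteq> H'"
  proof
    fix v assume v: "v \<in> V"
    have "Max ((\<lambda>j. v $ j - ?p $ j) ` Jc) \<le> Max ((\<lambda>j. v $ j - x $ j) ` J)"
    \<comment> \<open>The bottom vector has no contact index to offer, but then all differences on
      the \<open>Jc\<close> side are \<open>-\<infinity>\<close> and the inequality is
      trivial.\<close>
    proof (cases "\<exists>m. v $ m > -\<infinity>")
      case True
      then obtain j where j: "j \<in> J" "\<And>k. v $ k - ?p $ k \<le> v $ j - x $ j"
        using exists_contact_index[OF assms(1,2,3,5) v] unfolding J by blast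
      have "v $ j - x $ j \<le> Max ((\<lambda>j. v $ j - x $ j) ` J)"
        using j(1) by (intro Max_ge) auto
      then show ?thesis
        using j(2) Jc_ne by (intro Max.boundedI) (auto intro: order_trans)
    next
      case False
      then have bot: "v $ k = -\<infinity>" for k
        by auto
      have "v $ k - ?p $ k = -\<infinity>" for k
        using bot[of k] pfin[of k] by (cases "?p $ k") auto
      then show ?thesis
        using Jc_ne by auto
    qed
    then show "v \<in> H'"
      using v sub by (auto simp: H')
  qed
  moreover have "x \<notin> H'"
  proof -
    \<comment> \<open>At \<open>h = x\<close> the \<open>J\<close> side equals 0, while the index
      \<open>m\<close>, where \<open>x\<close> exceeds its projection, makes the \<open>Jc\<close>
      side positive.\<close>
    have "x $ j - x $ j = 0" for j
      using xfin[of j] by (cases "x $ j") auto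
    then have zero: "Max ((\<lambda>j. x $ j - x $ j) ` J) = 0"
      by (simp only: image_constant_conv J_ne if_False Max_singleton)
    have "0 < x $ m - ?p $ m"
      using m xfin[of m] pfin[of m] unfolding Jc
      by (cases "x $ m"; cases "?p $ m") auto
    also have "\<dots> \<le> Max ((\<lambda>j. x $ j - ?p $ j) ` Jc)"
      using m by (intro Max_ge) auto
    finally show ?thesis
      unfolding H' mem_Collect_eq zero by (simp add: not_le)
  qed
  moreover have "H' = {h \<in> rmax_vecs.
      Min ((\<lambda>j. resid (h $ j) (x $ j)) ` J) \<le> Min ((\<lambda>j. resid (h $ j) (?p $ j)) ` Jc)}"
  proof -
    \<comment> \<open>Negation reverses the order, so comparing these minima is the same as
      comparing the maxima the other way round.\<close>
    have resid_Min: "Min ((\<lambda>j. resid (h $ j) (c $ j)) ` C) = - Max ((\<lambda>j. h $ j - c $ j) ` C)"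
      if "h \<in> rmax_vecs" "C \<noteq> {}" "\<And>i. \<bar>c $ i\<bar> \<noteq> \<infinity>" for h c :: "ereal ^ 'n" and C
      using that Min_uminus_ereal[of C "\<lambda>j. h $ j - c $ j"]
      by (simp add: resid_eq_uminus_diff rmax_vecs_def rmax_def)
    show ?thesis
      unfolding H' using resid_Min[OF _ J_ne xfin] resid_Min[OF _ Jc_ne pfin] by auto
  qed
  ultimately show ?thesis
    using half by blast
qed

end
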